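(* For all integers $k$ and $n$ with $3 \le k \le n^{1/2}$, $$f_k(n) \le 32\,(kn)^{1/3}.$$
   Context: $[n]=\{1,\ldots,n\}$. A permutation $\pi$ on $[n]$ is identified with the sequence $\pi(1)\ \pi(2)\ \cdots\ \pi(n)$. A subsequence need not consist of consecutive terms. A sequence $a_1\ \cdots\ a_m$ is a common subsequence in a set $S=\{\pi_1,\ldots,\pi_k\}$ of $k$ permutations on $[n]$ if it is a subsequence of both $\pi_i(1)\ \cdots\ \pi_i(n)$ and $\pi_j(1)\ \cdots\ \pi_j(n)$ for some distinct $\pi_i,\pi_j\in S$. $f_k(n)$ denotes the maximum integer $m$ such that every set of $k$ permutations on $[n]$ contains a common subsequence of length $m$. *)

theory Defs
  imports Complex_Main "HOL-Library.Sublist" "HOL-Combinatorics.Permutations"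
begin

definition perm_seq :: "nat \<Rightarrow> (nat \<Rightarrow> nat) \<Rightarrow> nat list" where
  "perm_seq n \<pi> = map \<pi> [1..<Suc n]"

text \<open>A common subsequence in a set of permutations is one shared by two distinct members of
  the set, not by all of them.  Here \<^const>\<open>subseq\<close> is the relation of being a
  not necessarily contiguous subsequence.\<close>

definition common_subseq_in :: "nat \<Rightarrow> (nat \<Rightarrow> nat) set \<Rightarrow> nat list \<Rightarrow> bool" where
  "common_subseq_in n S a \<longleftrightarrow>
     (\<exists>\<pi>\<in>S. \<exists>\<sigma>\<in>S. \<pi> \<noteq> \<sigma> \<and> subseq a (perm_seq n \<pi>) \<and> subseq a (perm_seq n \<sigma>))"

definition forced_lengths :: "nat \<Rightarrow> nat \<Rightarrow> nat set" where
  "forced_lengths k n =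
     {m. \<forall>S. S \<subseteq> {\<pi>. \<pi> permutes {1..n}} \<and> card S = k \<longrightarrow>
           (\<exists>a. common_subseq_in n S a \<and> length a = m)}"

definition f_lcs :: "nat \<Rightarrow> nat \<Rightarrow> nat" where
  "f_lcs k n = Max (forced_lengths k n)"

text \<open>The maximum exists whenever \<open>2 \<le> k \<le> n!\<close>; outside this range the value of
  \<open>f_lcs k n\<close> carries no meaning.\<close>

lemma zero_in_forced_lengths:
  assumes "2 \<le> k"
  shows "0 \<in> forced_lengths k n"
proof -
  have "\<exists>a. common_subseq_in n S a \<and> length a = 0" if "card S = k" for S
  proof -
    have "\<exists>\<pi>\<in>S. \<exists>\<sigma>\<in>S. \<pi> \<noteq> \<sigma>"
    proof (rule ccontr)
      assume "\<not> ?thesis"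
      then have "card S \<le> Suc 0"
        by (metis card.infinite card_le_Suc0_iff_eq le0)
      with that assms show False by simp
    qed
    then show ?thesis by (auto simp: common_subseq_in_def)
  qed
  then show ?thesis by (simp add: forced_lengths_def)
qed

lemma finite_forced_lengths:
  assumes "k \<le> fact n"
  shows "finite (forced_lengths k n)"
proof -
  have "card {\<pi>. \<pi> permutes {1..n}} = fact n"
    by (rule card_permutations) simp_all
  with assms obtain S where S: "S \<subseteq> {\<pi>. \<pi> permutes {1..n}}" "card S = k"
    by (metis obtain_subset_with_card_n)
  have "m \<le> n" if "m \<in> forced_lengths k n" for m
  proof -
    from that S obtain a where "common_subseq_in n S a" "length a = m"
      unfolding forced_lengths_def by blast
    then show ?thesis
      unfolding common_subseq_in_def perm_seq_def
      by (auto dest!: list_emb_length simp del: upt_Suc)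
  qed
  then show ?thesis by (meson finite_nat_set_iff_bounded_le)
qed

end

theory Submission
  imports Defs "HOL-Computational_Algebra.Primes" "HOL-Library.Discrete_Functions"
    "HOL-Library.Product_Lexorder"
begin

text \<open>
  The bound is witnessed by \<open>k\<close> explicit permutations.  Take a prime \<open>p\<close> of size about
  \<open>(kn)\<^sup>1\<^sup>/\<^sup>3\<close> and write the elements of \<open>{1..n}\<close> as points \<open>(x, y, z)\<close> with \<open>x, y\<close> residues
  modulo \<open>p\<close> and \<open>0 \<le> z < p / k\<close>; since \<open>p \<cdot> p \<cdot> (p / k)\<close> is at least \<open>n\<close> there is room for
  all of them.  The \<open>i\<close>-th permutation sorts the points by the residue
  \<open>l\<^sub>i = (x + iy + i\<^sup>2z) mod p\<close>, and points with the same \<open>l\<^sub>i\<close> by the integer \<open>m\<^sub>i = -y - 2iz\<close>.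

  Consider a common subsequence for two slopes \<open>i \<noteq> j\<close>.  Along it both \<open>l\<^sub>i\<close> and \<open>l\<^sub>j\<close> are
  nondecreasing, so it walks monotonically through the \<open>p \<times> p\<close> cells \<open>(l\<^sub>i, l\<^sub>j)\<close> and meets at
  most \<open>2p - 1\<close> of them.  A cell is a line modulo \<open>p\<close> parametrized by \<open>z\<close>: subtracting
  the two congruences and cancelling \<open>i - j\<close> shows that \<open>y + (i + j)z\<close> is constant modulo \<open>p\<close> on it.
  As an integer this quantity lies in \<open>[0, 3p)\<close>, because \<open>kz < p\<close>, so the line breaks into at
  most three pieces on which \<open>y + (i + j)z\<close> is really constant.  On a piece, \<open>m\<^sub>i\<close> is
  \<open>(j - i)z\<close> and \<open>m\<^sub>j\<close> is \<open>(i - j)z\<close>, up to a constant: the two permutations run through the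
  piece in opposite directions, and the subsequence contains at most one of its points.
  Hence every common subsequence has length at most \<open>3(2p - 1) \<le> 6p\<close>
  (\<open>length_common_subseq_slope_lists_le\<close>).

  It remains to find \<open>p\<close>.  With \<open>N\<close> the cube root of \<open>kn\<close> rounded up, a prime between \<open>N\<close> and
  \<open>4N\<close> is good enough, since then \<open>6p \<le> 24N \<le> 32(kn)\<^sup>1\<^sup>/\<^sup>3\<close>; the last step uses
  \<open>(kn)\<^sup>1\<^sup>/\<^sup>3 \<ge> k \<ge> 3\<close>.  Such a prime exists by a weak form of Bertrand's postulate
  (\<open>prime_between_and_4_times\<close>).
\<close>

section \<open>Prime powers in binomial coefficients\<close>

text \<open>
  The reciprocals of \<open>k (n choose k)\<close> form Leibniz's harmonic triangle:
  \<open>1 / ((k+1) ((N+1) choose (k+1))) = 1 / (k (N choose k)) - 1 / (k ((N+1) choose k))\<close>.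
  A number divisible by both denominators on the right is therefore divisible by the one on
  the left, which drives the induction on \<open>k\<close>.
\<close>

lemma times_binomial_dvd_common_multiple:
  fixes m :: nat
  assumes "1 \<le> k" "k \<le> n" "\<And>i. 1 \<le> i \<Longrightarrow> i \<le> n \<Longrightarrow> i dvd m"
  shows "k * (n choose k) dvd m"
  using assms
proof (induction k arbitrary: n)
  case 0
  then show ?case by simp
next
  case (Suc k)
  show ?case
  proof (cases "k = 0")
    case True
    with Suc.prems show ?thesis by simp
  next
    case False
    obtain N where n: "n = Suc N" and "k \<le> N"
      using Suc.prems(2) by (cases n) auto
    define B C where "B = int (Suc N choose k)" and "C = int (N choose k)"
    have "k * (N choose k) dvd m" "k * (Suc N choose k) dvd m"
      using Suc.IH[of N] Suc.IH[of "Suc N"] Suc.prems \<open>k \<noteq> 0\<close> \<open>k \<le> N\<close> by (auto simp: n)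
    then obtain x y where x: "m = k * (N choose k) * x" and y: "m = k * (Suc N choose k) * y"
      by (meson dvdE)
    have m: "int m = int k * C * int x" "int m = int k * B * int y"
      unfolding B_def C_def by (subst x, simp, subst y, simp)
    have "(Suc N - k) * (Suc N choose k) = Suc N * (N choose k)"
      using binomial_absorb_comp[of "Suc N" k] by simp
    then have absorb: "(int (Suc N) - int k) * B = int (Suc N) * C"
      unfolding B_def C_def using \<open>k \<le> N\<close>
      by (metis of_nat_mult of_nat_diff le_SucI)
    have "int k * (C * x) = int k * (B * y)"
      using m by (metis mult.assoc)
    then have "C * x = B * y" using \<open>k \<noteq> 0\<close> by simp
    then have "int m = int (Suc N) * (C * x - B * y) + int m" by simp
    also have "\<dots> = int (Suc N) * C * x - (int (Suc N) - int k) * B * y"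
      unfolding m(2) by (simp add: algebra_simps)
    also have "\<dots> = int (Suc N) * C * (int x - int y)"
      unfolding absorb by (simp add: algebra_simps)
    finally have "int (Suc N) * C dvd int m" by simp
    then have "Suc N * (N choose k) dvd m"
      unfolding C_def by (metis of_nat_dvd_iff of_nat_mult)
    then show ?thesis unfolding n Suc_times_binomial .
  qed
qed

text \<open>
  Write \<open>p\<^sup>f\<close> for the largest power of \<open>p\<close> dividing one of \<open>1, \<dots>, n\<close>.  Then \<open>p\<^sup>f\<close> times the
  \<open>p\<close>-free parts of these numbers is a common multiple of them, hence a multiple of the
  binomial coefficient, and all of its factors \<open>p\<close> come from \<open>p\<^sup>f \<le> n\<close>.
\<close>

lemma prime_power_in_binomial_le:
  fixes p :: nat
  assumes "prime p" "1 \<le> k" "k \<le> n"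
  shows "p ^ multiplicity p (n choose k) \<le> n"
proof -
  define free where "free i = i div p ^ multiplicity p i" for i
  have split: "i = p ^ multiplicity p i * free i" for i
    unfolding free_def by (simp add: multiplicity_dvd)
  define f where "f = Max ((\<lambda>i. multiplicity p i) ` {1..n})"
  have f_le: "multiplicity p i \<le> f" if "i \<in> {1..n}" for i
    unfolding f_def using that by (intro Max_ge) auto
  have "f \<in> (\<lambda>i. multiplicity p i) ` {1..n}"
    unfolding f_def using assms by (intro Max_in) auto
  then obtain j where j: "j \<in> {1..n}" "f = multiplicity p j" by auto
  have "p ^ f \<le> j" unfolding j(2) using j(1) by (intro dvd_imp_le multiplicity_dvd) auto
  with j have pf: "p ^ f \<le> n" by auto
  define c where "c = (\<Prod>i\<in>{1..n}. free i)"
  have "coprime p (free i)" if "i \<in> {1..n}" for i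
  proof -
    have "\<not> p dvd free i"
      unfolding free_def using that \<open>prime p\<close>
      by (intro multiplicity_decompose) (auto simp: prime_nat_iff)
    then show ?thesis using \<open>prime p\<close> by (simp add: prime_imp_coprime)
  qed
  then have "coprime p c" unfolding c_def by (intro prod_coprime_right) auto
  have "k * (n choose k) dvd p ^ f * c"
  proof (rule times_binomial_dvd_common_multiple)
    fix i assume i: "1 \<le> i" "i \<le> n"
    have "p ^ multiplicity p i * free i dvd p ^ f * c"
      unfolding c_def using f_le i
      by (intro mult_dvd_mono le_imp_power_dvd dvd_prodI) auto
    then show "i dvd p ^ f * c" using split by metis
  qed (use assms in auto)
  then have "p ^ multiplicity p (n choose k) dvd p ^ f * c"
    by (rule dvd_trans[OF dvd_mult[OF multiplicity_dvd]])
  moreover have "coprime (p ^ multiplicity p (n choose k)) c"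
    using \<open>coprime p c\<close> by simp
  ultimately have "p ^ multiplicity p (n choose k) dvd p ^ f"
    by (simp add: coprime_dvd_mult_left_iff)
  then have "p ^ multiplicity p (n choose k) \<le> p ^ f"
    using \<open>prime p\<close> by (intro dvd_imp_le) (auto simp: prime_gt_0_nat)
  with pf show ?thesis by simp
qed

section \<open>A prime between a number and four times that number\<close>

lemma prod_primes_dvd:
  fixes m :: nat
  assumes "finite A" "\<And>p. p \<in> A \<Longrightarrow> prime p" "\<And>p. p \<in> A \<Longrightarrow> p dvd m"
  shows "\<Prod>A dvd m"
  using assms
proof (induction A)
  case (insert q A)
  have "coprime q (\<Prod>A)"
    using insert by (intro prod_coprime_right) (auto intro: primes_coprime)
  then show ?case using insert by (simp add: divides_mult)
qed simp

text \<open>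
  Erdos's argument: for \<open>n = 2r + 1\<close> the primes in \<open>(r + 1, n]\<close> all divide \<open>n choose r\<close>,
  which is at most \<open>4\<^sup>r\<close> because it occurs twice in row \<open>n\<close> of Pascal's triangle.
\<close>

lemma primorial_le_4_power: "\<Prod>{p. prime p \<and> p \<le> n} \<le> (4::nat) ^ n"
proof (induction n rule: less_induct)
  case (less n)
  have fin: "finite {p. prime p \<and> p \<le> r}" for r :: nat
    by (rule finite_subset[of _ "{..r}"]) auto
  consider "n \<le> 1" | "n = 2" | "n > 2" "even n" | "n > 2" "odd n" by linarith
  then show ?case
  proof cases
    case 1
    then have "\<not> prime p \<or> \<not> p \<le> n" for p
      using prime_ge_2_nat[of p] by linarith
    then have "{p. prime p \<and> p \<le> n} = {}" by blast
    then show ?thesis by (simp only: prod.empty) simp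
  next
    case 2
    have "prime p \<and> p \<le> n \<longleftrightarrow> p = 2" for p
      using prime_ge_2_nat[of p] 2 two_is_prime_nat by (metis le_antisym)
    then have "{p. prime p \<and> p \<le> n} = {2}" by blast
    with 2 show ?thesis by simp
  next
    case 3
    have "\<not> prime n" using 3 prime_odd_nat by blast
    then have "prime p \<and> p \<le> n \<longleftrightarrow> prime p \<and> p \<le> n - 1" for p
      using 3 by (cases "p = n") auto
    then have "{p. prime p \<and> p \<le> n} = {p. prime p \<and> p \<le> n - 1}" by blast
    then have "\<Prod>{p. prime p \<and> p \<le> n} \<le> 4 ^ (n - 1)"
      using less[of "n - 1"] 3 by simp
    also have "\<dots> \<le> (4::nat) ^ n" by (intro power_increasing) auto
    finally show ?thesis .
  next
    case 4
    then obtain r where n: "n = 2 * r + 1" by (auto elim: oddE)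
    with 4 have "r \<ge> 1" by linarith
    let ?A = "{p. prime p \<and> r + 1 < p \<and> p \<le> n}"
    have "{p. prime p \<and> p \<le> n} = {p. prime p \<and> p \<le> r + 1} \<union> ?A"
      using n by auto
    then have "\<Prod>{p. prime p \<and> p \<le> n} = \<Prod>{p. prime p \<and> p \<le> r + 1} * \<Prod>?A"
      using fin[of n] fin[of "r+1"] by (subst prod.union_disjoint[symmetric]) auto
    also have "\<Prod>{p. prime p \<and> p \<le> r + 1} \<le> 4 ^ (r + 1)"
      using less[of "r + 1"] n \<open>r \<ge> 1\<close> by simp
    also have "\<Prod>?A \<le> (n choose r)"
    proof (rule dvd_imp_le)
      show "\<Prod>?A dvd (n choose r)"
      proof (rule prod_primes_dvd)
        fix p assume p: "p \<in> ?A"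
        have "fact r * fact (n - r) * (n choose r) = (fact n :: nat)"
          using n by (intro binomial_fact_lemma) auto
        moreover have "p dvd fact n" using p by (simp add: prime_dvd_fact_iff)
        ultimately have "p dvd fact r * fact (r + 1) * (n choose r)"
          using n by simp
        moreover have "\<not> p dvd fact r" "\<not> p dvd fact (r + 1)"
          using p by (simp_all only: mem_Collect_eq prime_dvd_fact_iff not_le) auto
        ultimately show "p dvd (n choose r)"
          using p prime_dvd_mult_iff[of p] by blast
      qed (use fin[of n] in auto)
    qed (use n in simp)
    also have "(n choose r) \<le> 4 ^ r"
    proof -
      have "2 * (n choose r) = (\<Sum>i\<in>{r, r + 1}. n choose i)"
        using binomial_symmetric[of r n] n by (simp add: mult_2)
      also have "\<dots> \<le> (\<Sum>i\<le>n. n choose i)"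
        using n by (intro sum_mono2) auto
      also have "\<dots> = 2 * 4 ^ r"
        unfolding choose_row_sum by (simp add: n power_mult)
      finally show ?thesis by simp
    qed
    finally have "\<Prod>{p. prime p \<and> p \<le> n} \<le> 4 ^ (r + 1) * 4 ^ r" by simp
    also have "\<dots> = (4::nat) ^ n" unfolding n by (simp add: mult_2 power_add)
    finally show ?thesis .
  qed
qed

lemma Suc_power4_le: "17 \<le> a \<Longrightarrow> (a + 1) ^ 4 \<le> (2::nat) ^ a"
proof (induction a rule: dec_induct)
  case base
  then show ?case by simp
next
  case (step a)
  have "(a + 1) ^ 2 * 6 \<le> (a + 1) ^ 2 * (a + 1)"
    using step by (intro mult_left_mono) auto
  moreover have "4 * (a + 1) + 1 \<le> (a + 1) * (a + 1) * (a + 1)"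
  proof -
    have "4 * (a + 1) + 1 \<le> 5 * (a + 1)" by simp
    also have "\<dots> \<le> ((a + 1) * (a + 1)) * (a + 1)"
      using step mult_le_mono[of 5 "a + 1" 1 "a + 1"] by (intro mult_right_mono) auto
    finally show ?thesis .
  qed
  moreover have "(a + 1) ^ 3 * 6 \<le> (a + 1) ^ 3 * (a + 1)"
    using step by (intro mult_left_mono) auto
  ultimately have "(Suc a + 1) ^ 4 \<le> 2 * (a + 1) ^ 4"
    by (simp add: power_def algebra_simps numeral_eq_Suc)
  then show ?case using step by simp
qed

text \<open>
  If there were no such prime, every prime factor of \<open>C = 4N choose 2N\<close> would be at most
  \<open>N\<close>.  Those above \<open>a = \<lfloor>\<surd>(4N)\<rfloor>\<close> occur only to the first power and together contribute at
  most the primorial \<open>4\<^sup>N\<close>; the fewer than \<open>a\<close> others contribute at most \<open>4N\<close> each.  This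
  contradicts \<open>C \<ge> 4\<^sup>2\<^sup>N / 4N\<close> as soon as \<open>a \<ge> 17\<close>, that is, for \<open>N \<ge> 73\<close>.
\<close>

lemma prime_between_and_4_times:
  fixes N :: nat
  assumes "N \<ge> 1"
  obtains p where "prime p" "N < p" "p \<le> 4 * N"
proof (cases "N < 73")
  case True
  have "prime (3::nat)" "prime (11::nat)" "prime (43::nat)" "prime (167::nat)"
    by simp_all
  note primes = this
  consider "N < 3" | "3 \<le> N" "N < 11" | "11 \<le> N" "N < 43" | "43 \<le> N" by linarith
  then show ?thesis
  proof cases
    case 1
    with assms show ?thesis by (intro that[OF primes(1)]) simp_all
  next
    case 2
    then show ?thesis by (intro that[OF primes(2)]) simp_all
  next
    case 3
    then show ?thesis by (intro that[OF primes(3)]) simp_all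
  next
    case 4
    with True show ?thesis by (intro that[OF primes(4)]) simp_all
  qed
next
  case False
  define a where "a = floor_sqrt (4 * N)"
  have a: "a ^ 2 \<le> 4 * N" "4 * N < (a + 1) ^ 2"
    using Suc_floor_sqrt_power2_gt[of "4 * N"] by (simp_all add: a_def)
  have "17 \<le> a"
    unfolding a_def using False by (intro le_floor_sqrtI) (simp add: power2_eq_square)
  define P where "P = {p::nat. prime p \<and> p \<le> N}"
  have "finite P" unfolding P_def by (rule finite_subset[of _ "{..N}"]) auto
  define C where "C = 4 * N choose (2 * N)"
  have "C \<noteq> 0" unfolding C_def by simp
  show ?thesis
  proof (rule ccontr)
    assume no_prime: "\<not> ?thesis"
    have prime_power: "q ^ multiplicity q C \<le> 4 * N" if "prime q" for q
      unfolding C_def using that assms by (intro prime_power_in_binomial_le) auto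
    have "prime_factors C \<subseteq> P"
    proof
      fix q assume q: "q \<in> prime_factors C"
      then have "prime q" by auto
      moreover have "multiplicity q C \<ge> 1"
        using q by (simp add: prime_factors_multiplicity)
      then have "q ^ 1 \<le> q ^ multiplicity q C"
        using \<open>prime q\<close> by (intro power_increasing) (simp_all add: prime_gt_0_nat Suc_leI)
      then have "q \<le> 4 * N" using prime_power[OF \<open>prime q\<close>] by simp
      ultimately show "q \<in> P" using no_prime that unfolding P_def
        by (metis (mono_tags, lifting) mem_Collect_eq not_le)
    qed
    have "C = (\<Prod>q\<in>prime_factors C. q ^ multiplicity q C)"
      using prod_prime_factors[OF \<open>C \<noteq> 0\<close>] by simp
    also have "\<dots> = (\<Prod>q\<in>P. q ^ multiplicity q C)"
      using \<open>finite P\<close> \<open>prime_factors C \<subseteq> P\<close>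
      by (intro prod.mono_neutral_left) (auto simp: P_def prime_factors_multiplicity)
    \<comment> \<open>The spare factor \<open>q\<close> at the small primes completes the large ones to a primorial.\<close>
    also have "\<dots> \<le> (\<Prod>q\<in>P. (if q \<le> a then 4 * N else 1) * q)"
    proof (rule prod_mono, safe)
      fix q assume "q \<in> P"
      then have q: "prime q" by (simp add: P_def)
      show "q ^ multiplicity q C \<le> (if q \<le> a then 4 * N else 1) * q"
      proof (cases "q \<le> a")
        case True
        have "q ^ multiplicity q C * 1 \<le> 4 * N * q"
          using prime_power[OF q] prime_ge_1_nat[OF q] by (intro mult_le_mono)
        with True show ?thesis by simp
      next
        case False
        have "multiplicity q C \<le> 1"
        proof (rule ccontr)
          assume "\<not> ?thesis"
          then have "q ^ 2 \<le> q ^ multiplicity q C"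
            using q by (intro power_increasing) (simp_all add: prime_gt_0_nat Suc_leI)
          moreover have "(a + 1) ^ 2 \<le> q ^ 2" using False by (intro power_mono) auto
          ultimately show False using a prime_power[OF q] by linarith
        qed
        then have "q ^ multiplicity q C \<le> q ^ 1"
          using q by (intro power_increasing) (simp_all add: prime_gt_0_nat Suc_leI)
        with False show ?thesis by simp
      qed
    qed
    also have "\<dots> = (\<Prod>q\<in>P. if q \<le> a then 4 * N else 1) * \<Prod>P"
      by (simp add: prod.distrib)
    also have "(\<Prod>q\<in>P. if q \<le> a then 4 * N else 1) = (4 * N) ^ card {q \<in> P. q \<le> a}"
      using \<open>finite P\<close> by (simp add: prod.If_cases Int_def)
    also have "\<dots> \<le> (4 * N) ^ (a - 1)"
    proof (rule power_increasing)
      \<comment> \<open>Leaving out \<open>1\<close> gives the exponent \<open>a - 1\<close>, which absorbs the factor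
        \<open>4N\<close> lost in the lower bound for \<open>C\<close>.\<close>
      have "{q \<in> P. q \<le> a} \<subseteq> {2..a}" by (auto simp: P_def dest: prime_ge_2_nat)
  from card_mono[OF _ this] show "card {q \<in> P. q \<le> a} \<le> a - 1" by simp
    qed (use assms in auto)
    also have "\<Prod>P \<le> 4 ^ N" unfolding P_def by (rule primorial_le_4_power)
    finally have C_le: "C \<le> (4 * N) ^ (a - 1) * 4 ^ N" by simp
    have "real (4 ^ (2 * N)) \<le> real (4 * N * C)"
      using central_binomial_lower_bound[of "2 * N"] assms
      by (simp add: C_def field_simps)
    then have "4 ^ (2 * N) \<le> 4 * N * C" by (simp only: of_nat_le_iff)
    also have "\<dots> \<le> 4 * N * ((4 * N) ^ (a - 1) * 4 ^ N)"
      using C_le by (intro mult_left_mono) auto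
    also have "\<dots> = (4 * N) ^ a * 4 ^ N"
      using \<open>17 \<le> a\<close> by (cases a) auto
    finally have "4 ^ N * 4 ^ N \<le> (4 * N) ^ a * (4::nat) ^ N"
      by (simp add: mult_2 power_add)
    then have "4 ^ N \<le> (4 * N) ^ a" by simp
    also have "\<dots> < ((a + 1) ^ 2) ^ a"
      using a \<open>17 \<le> a\<close> by (intro power_strict_mono) auto
    \<comment> \<open>Squaring makes the comparison of \<open>(a + 1)\<^sup>4\<close> with \<open>2\<^sup>a\<close> applicable for odd \<open>a\<close>, too.\<close>
    finally have "(4 ^ N) ^ 2 < (((a + 1) ^ 2) ^ a) ^ (2::nat)"
      by (intro power_strict_mono) auto
    also have "\<dots> = ((a + 1) ^ 4) ^ a" by (simp flip: power_mult)
    also have "\<dots> \<le> (2 ^ a) ^ a"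
      using Suc_power4_le[OF \<open>17 \<le> a\<close>] by (intro power_mono) auto
    also have "\<dots> = 2 ^ (a ^ 2)" by (simp add: power2_eq_square power_mult)
    also have "\<dots> \<le> 2 ^ (4 * N)" using a by (intro power_increasing) auto
    also have "\<dots> = ((4::nat) ^ N) ^ 2"
    proof -
      have "(4::nat) ^ N = 2 ^ (2 * N)" by (simp add: power_mult)
      then show ?thesis by (simp flip: power_mult)
    qed
    finally show False by simp
  qed
qed

section \<open>Sorting points along slopes\<close>

text \<open>
  The second component is the derivative of \<open>-(x + iy + i\<^sup>2z)\<close> with respect to \<open>i\<close>.  The
  line on which \<open>x + iy + i\<^sup>2z\<close> and \<open>x + jy + j\<^sup>2z\<close> are both constant has direction
  \<open>(ij, -(i + j), 1)\<close>, and the derivative grows at rate \<open>j - i\<close> along it: the sign changes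
  when \<open>i\<close> and \<open>j\<close> trade places.
\<close>

fun slope_key :: "int \<Rightarrow> int \<Rightarrow> int \<times> int \<times> int \<Rightarrow> int \<times> int" where
  "slope_key p i (x, y, z) = ((x + i * y + i\<^sup>2 * z) mod p, - y - 2 * i * z)"

text \<open>
  Along a chain on which two residues are nondecreasing, their sum determines both of them.
  The second component tells apart the stretches between two jumps of the residue \<open>y\<close> as \<open>z\<close>
  moves along the line inside a cell.
\<close>

fun cell_label :: "int \<Rightarrow> int \<Rightarrow> int \<Rightarrow> int \<times> int \<times> int \<Rightarrow> int \<times> int" where
  "cell_label p i j (x, y, z) =
     (fst (slope_key p i (x, y, z)) + fst (slope_key p j (x, y, z)), (y + (i + j) * z) div p)"

text \<open>
  The bound \<open>k * z < p\<close> limits how often \<open>y\<close> can wrap around modulo \<open>p\<close> within a cell.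
\<close>

definition box :: "int \<Rightarrow> int \<Rightarrow> (int \<times> int \<times> int) set" where
  "box p k = {(x, y, z). 0 \<le> x \<and> x < p \<and> 0 \<le> y \<and> y < p \<and> 0 \<le> z \<and> k * z < p}"

text \<open>
  The difference of the two congruences is \<open>i - j\<close> times the difference of the invariant, and
  \<open>i - j\<close> is invertible modulo the prime \<open>p\<close>.
\<close>

lemma line_invariant_cong:
  fixes p :: int
  assumes "prime p" "0 \<le> i" "i < p" "0 \<le> j" "j < p" "i \<noteq> j"
    and "(x + i * y + i\<^sup>2 * z) mod p = (x' + i * y' + i\<^sup>2 * z') mod p"
    and "(x + j * y + j\<^sup>2 * z) mod p = (x' + j * y' + j\<^sup>2 * z') mod p"
  shows "(y + (i + j) * z) mod p = (y' + (i + j) * z') mod p"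
proof -
  let ?d = "(y + (i + j) * z) - (y' + (i + j) * z')"
  have "p dvd ((x + i * y + i\<^sup>2 * z) - (x' + i * y' + i\<^sup>2 * z'))
            - ((x + j * y + j\<^sup>2 * z) - (x' + j * y' + j\<^sup>2 * z'))"
    using assms(7,8) unfolding mod_eq_dvd_iff by (rule dvd_diff)
  also have "\<dots> = (i - j) * ?d" by (simp add: algebra_simps power2_eq_square)
  finally have "p dvd i - j \<or> p dvd ?d"
    using \<open>prime p\<close> prime_dvd_mult_iff by blast
  moreover have "\<not> p dvd i - j"
    using assms(2-6) zdvd_imp_le[of p "i - j"] zdvd_imp_le[of p "j - i"] dvd_diff_commute[of p i j]
    by (cases "i < j") auto
  ultimately show ?thesis unfolding mod_eq_dvd_iff by blast
qed

text \<open>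
  Two points of one piece of a cell are listed in opposite orders for the slopes \<open>i\<close> and \<open>j\<close>,
  so they can be in the same order for both only if they coincide.
\<close>

lemma eq_if_keys_le_and_cell_label_eq:
  assumes "prime p" "0 \<le> i" "i < p" "0 \<le> j" "j < p" "i \<noteq> j"
    and "P \<in> box p k" "Q \<in> box p k"
    and "slope_key p i P \<le> slope_key p i Q" "slope_key p j P \<le> slope_key p j Q"
    and "cell_label p i j P = cell_label p i j Q"
  shows "P = Q"
proof -
  obtain x y z x' y' z' where P: "P = (x, y, z)" and Q: "Q = (x', y', z')"
    by (cases P, cases Q) auto
  let ?l = "\<lambda>i x y z. (x + i * y + i\<^sup>2 * z) mod p"
  have le: "?l i x y z \<le> ?l i x' y' z'" "?l j x y z \<le> ?l j x' y' z'"
    using assms(9,10) unfolding P Q by auto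
  moreover have "?l i x y z + ?l j x y z = ?l i x' y' z' + ?l j x' y' z'"
    using assms(11) unfolding P Q by simp
  ultimately have l: "?l i x y z = ?l i x' y' z'" "?l j x y z = ?l j x' y' z'"
    by linarith+
  have "(y + (i + j) * z) mod p = (y' + (i + j) * z') mod p"
    by (rule line_invariant_cong[OF assms(1-6) l])
  moreover have "(y + (i + j) * z) div p = (y' + (i + j) * z') div p"
    using assms(11) unfolding P Q by simp
  ultimately have line: "y + (i + j) * z = y' + (i + j) * z'"
    by (metis div_mult_mod_eq)
  have "- y - 2 * i * z \<le> - y' - 2 * i * z'" "- y - 2 * j * z \<le> - y' - 2 * j * z'"
    using assms(9,10) l unfolding P Q by auto
  \<comment> \<open>Adding the line equation turns these into \<open>(j - i)z \<le> (j - i)z'\<close> and its reverse.\<close>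
  with line have "(j - i) * (z - z') = 0" by (simp add: algebra_simps)
  with \<open>i \<noteq> j\<close> have "z = z'" by simp
  with line have "y = y'" by simp
  from l(1) have "(x + (i * y + i\<^sup>2 * z)) mod p = (x' + (i * y + i\<^sup>2 * z)) mod p"
    unfolding \<open>z = z'\<close> \<open>y = y'\<close> by (simp add: add.assoc)
  then have "p dvd x - x'" by (simp add: mod_eq_dvd_iff)
  then have "x mod p = x' mod p" by (simp add: mod_eq_dvd_iff)
  then have "x = x'" using assms(7,8) unfolding P Q box_def by simp
  with \<open>y = y'\<close> \<open>z = z'\<close> show ?thesis unfolding P Q by simp
qed

lemma cell_label_in:
  assumes "p > 0" "0 \<le> i" "i < k" "0 \<le> j" "j < k" "P \<in> box p k"
  shows "cell_label p i j P \<in> {0..2 * p - 2} \<times> {0..2}"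
proof -
  obtain x y z where P: "P = (x, y, z)" by (cases P) auto
  have b: "0 \<le> y" "y < p" "0 \<le> z" "k * z < p" using assms(6) unfolding P box_def by auto
  have "(i + j) * z \<le> (2 * k) * z" using assms b by (intro mult_right_mono) auto
  with b have "y + (i + j) * z < 3 * p" by simp
  then have "(y + (i + j) * z) div p * p < 3 * p"
    using div_mult_mod_eq[of "y + (i + j) * z" p] pos_mod_sign[OF \<open>p > 0\<close>, of "y + (i + j) * z"]
    by linarith
  then have "(y + (i + j) * z) div p < 3" using \<open>p > 0\<close> by simp
  moreover have "0 \<le> (y + (i + j) * z) div p"
    using assms b by (simp add: pos_imp_zdiv_nonneg_iff)
  moreover have "(x + i * y + i\<^sup>2 * z) mod p + (x + j * y + j\<^sup>2 * z) mod p \<in> {0..2 * p - 2}"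
  proof -
    have *: "0 \<le> t mod p \<and> t mod p \<le> p - 1" for t
      using \<open>p > 0\<close> pos_mod_bound[of p t] by simp
    show ?thesis
      using *[of "x + i * y + i\<^sup>2 * z"] *[of "x + j * y + j\<^sup>2 * z"]
      unfolding atLeastAtMost_iff by linarith
  qed
  ultimately show ?thesis unfolding P by simp
qed

text \<open>
  The labels on a common chain are distinct, and there are only \<open>3(2p - 1)\<close> labels.
\<close>

lemma length_common_chain_le:
  assumes "prime p" "k \<le> p" "0 \<le> i" "i < k" "0 \<le> j" "j < k" "i \<noteq> j"
    and "distinct Ps" "set Ps \<subseteq> box p k"
    and "sorted (map (slope_key p i) Ps)" "sorted (map (slope_key p j) Ps)"
  shows "int (length Ps) \<le> 6 * p"
proof -
  have "p > 0" using \<open>prime p\<close> by (simp add: prime_gt_0_int)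
  have inj: "inj_on (cell_label p i j) (set Ps)"
  proof (rule inj_onI)
    have *: "Ps ! r = Ps ! s"
      if "r \<le> s" "s < length Ps" "cell_label p i j (Ps ! r) = cell_label p i j (Ps ! s)" for r s
    proof (rule eq_if_keys_le_and_cell_label_eq[OF \<open>prime p\<close>, of i j _ k])
      show "Ps ! r \<in> box p k" "Ps ! s \<in> box p k"
        using that assms(9) by (auto dest: nth_mem)
      show "slope_key p i (Ps ! r) \<le> slope_key p i (Ps ! s)"
        "slope_key p j (Ps ! r) \<le> slope_key p j (Ps ! s)"
        using that sorted_nth_mono[OF assms(10), of r s] sorted_nth_mono[OF assms(11), of r s]
        by simp_all
    qed (use assms that in auto)
    fix P Q assume "P \<in> set Ps" "Q \<in> set Ps" and eq: "cell_label p i j P = cell_label p i j Q"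
    then obtain r s where "r < length Ps" "P = Ps ! r" "s < length Ps" "Q = Ps ! s"
      by (auto simp: in_set_conv_nth)
    then show "P = Q" using *[of r s] *[of s r] eq by (cases "r \<le> s") auto
  qed
  have "length Ps = card (set Ps)" using \<open>distinct Ps\<close> by (simp add: distinct_card)
  also have "\<dots> \<le> card ({0..2 * p - 2} \<times> {0..2::int})"
  proof (rule card_inj_on_le[OF inj])
    show "cell_label p i j ` set Ps \<subseteq> {0..2 * p - 2} \<times> {0..2}"
      using cell_label_in[OF \<open>p > 0\<close> assms(3-6)] assms(9) by blast
  qed simp
  also have "\<dots> = nat (2 * p - 1) * 3" by (simp add: card_cartesian_product)
  finally show ?thesis using \<open>p > 0\<close> by linarith
qed

section \<open>The permutations\<close>

text \<open>
  Base-\<open>p\<close> digits of \<open>a - 1\<close>, except that the third component carries everything above the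
  second digit; the shift is due to the ground set starting at \<open>1\<close>.
\<close>

definition digits :: "nat \<Rightarrow> nat \<Rightarrow> int \<times> int \<times> int" where
  "digits p a = (int ((a - 1) mod p), int ((a - 1) div p mod p), int ((a - 1) div p div p))"

lemma inj_on_digits: "inj_on (digits p) {1..n}"
proof (rule inj_onI)
  fix a b assume ab: "a \<in> {1..n}" "b \<in> {1..n}" and "digits p a = digits p b"
  then have "(a - 1) div p = (b - 1) div p" "(a - 1) mod p = (b - 1) mod p"
    unfolding digits_def prod.inject of_nat_eq_iff by (metis div_mult_mod_eq)+
  then have "a - 1 = b - 1" by (metis div_mult_mod_eq)
  moreover have "1 \<le> a" "1 \<le> b" using ab by simp_all
  ultimately show "a = b" by linarith
qed

lemma digits_in_box:
  assumes "p > 0" "a \<in> {1..n}" "k * n \<le> p ^ 3"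
  shows "digits p a \<in> box (int p) (int k)"
proof -
  let ?z = "(a - 1) div p div p"
  have "k * ?z < p"
  proof (cases "k = 0")
    case False
    have "?z * (p * p) \<le> a - 1" by (simp add: div_mult2_eq[symmetric])
    then have "?z * (p * p) < n" using assms(2) by auto
    then have "k * (?z * (p * p)) < k * n" using False by simp
    also have "\<dots> \<le> p * (p * p)" using assms(3) by (simp add: power3_eq_cube mult.assoc)
    finally have "(k * ?z) * (p * p) < p * (p * p)" by (simp only: mult.assoc)
    then show ?thesis by simp
  qed (use assms in simp)
  then have "int k * int ?z < int p" by (metis of_nat_less_iff of_nat_mult)
  then show ?thesis using assms(1) unfolding digits_def box_def by simp
qed

definition slope_list :: "nat \<Rightarrow> nat \<Rightarrow> nat \<Rightarrow> nat list" where
  "slope_list p n i = sort_key (slope_key (int p) (int i) \<circ> digits p) [1..<Suc n]"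

lemma length_common_subseq_slope_lists_le:
  assumes "prime p" "k \<le> p" "k * n \<le> p ^ 3" "i < k" "j < k" "i \<noteq> j"
    and "subseq a (slope_list p n i)" "subseq a (slope_list p n j)"
  shows "length a \<le> 6 * p"
proof -
  have list: "distinct (slope_list p n i)" "set (slope_list p n i) = {1..n}"
    by (auto simp: slope_list_def simp del: upt_Suc)
  obtain I where "a = nths (slope_list p n i) I"
    using assms(7) by (auto simp: subseq_conv_nths)
  then have a: "distinct a" "set a \<subseteq> {1..n}"
    using list set_nths_subset by (simp, metis)
  have sorted: "sorted (map (slope_key (int p) (int s)) (map (digits p) a))"
    if "subseq a (slope_list p n s)" for s
  proof -
    let ?f = "slope_key (int p) (int s) \<circ> digits p"
    have "subseq (map ?f a) (map ?f (slope_list p n s))"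
      using that by (rule subseq_map)
    moreover have "sorted (map ?f (slope_list p n s))"
      unfolding slope_list_def by (rule sorted_sort_key)
    ultimately have "sorted (map ?f a)"
      by (auto simp: subseq_conv_nths sorted_nths)
    then show ?thesis by simp
  qed
  have "int (length (map (digits p) a)) \<le> 6 * int p"
  proof (rule length_common_chain_le[where i = "int i" and j = "int j" and k = "int k"])
    show "distinct (map (digits p) a)"
      using a inj_on_subset[OF inj_on_digits] by (auto simp: distinct_map)
    show "set (map (digits p) a) \<subseteq> box (int p) (int k)"
      using a digits_in_box[OF prime_gt_0_nat[OF \<open>prime p\<close>] _ assms(3)] by auto
  qed (use assms sorted[OF assms(7)] sorted[OF assms(8)] in simp_all)
  then show ?thesis by simp
qed

lemma exists_permutation_with_seq:
  assumes "distinct xs" "set xs = {1..n}"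
  obtains \<pi> where "\<pi> permutes {1..n}" "perm_seq n \<pi> = xs"
proof
  define \<pi> where "\<pi> = (\<lambda>x. if x \<in> {1..n} then xs ! (x - 1) else x)"
  have len: "length xs = n" using assms distinct_card by fastforce
  have "bij_betw (\<lambda>x. x - 1) {1..n} {..<n}"
    by (rule bij_betw_byWitness[where f' = Suc]) auto
  then have "bij_betw ((!) xs \<circ> (\<lambda>x. x - 1)) {1..n} {1..n}"
    using bij_betw_nth[OF \<open>distinct xs\<close>, of "{..<n}" "{1..n}"] len assms
    by (auto intro: bij_betw_trans)
  then have "bij_betw \<pi> {1..n} {1..n}"
    by (rule bij_betw_cong[THEN iffD1, rotated]) (simp add: \<pi>_def)
  then show "\<pi> permutes {1..n}" by (rule bij_imp_permutes) (auto simp: \<pi>_def)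
  show "perm_seq n \<pi> = xs"
    unfolding perm_seq_def \<pi>_def by (rule nth_equalityI) (use len in \<open>auto simp del: upt_Suc\<close>)
qed

section \<open>From lists to the extremal function\<close>

text \<open>
  If \<open>b < n\<close>, the lists are pairwise different, because two equal ones would share a
  subsequence of length \<open>n\<close>; hence they come from a set of exactly \<open>k\<close> permutations.  If
  \<open>n \<le> b\<close>, the bound is trivial.
\<close>

lemma f_lcs_le:
  assumes "2 \<le> k" "k \<le> fact n"
    and L: "\<And>i. i < k \<Longrightarrow> distinct (L i)" "\<And>i. i < k \<Longrightarrow> set (L i) = {1..n}"
    and bound: "\<And>i j a. i < k \<Longrightarrow> j < k \<Longrightarrow> i \<noteq> j \<Longrightarrow> subseq a (L i) \<Longrightarrow> subseq a (L j)
                  \<Longrightarrow> length a \<le> b"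
  shows "f_lcs k n \<le> b"
proof -
  have "f_lcs k n \<in> forced_lengths k n"
    unfolding f_lcs_def using finite_forced_lengths[OF assms(2)] zero_in_forced_lengths[OF assms(1)]
    by (intro Max_in) auto
  then have forced: "\<exists>a. common_subseq_in n S a \<and> length a = f_lcs k n"
    if "S \<subseteq> {\<pi>. \<pi> permutes {1..n}}" "card S = k" for S
    using that unfolding forced_lengths_def by blast
  show ?thesis
  proof (cases "n \<le> b")
    case True
    have "card {\<pi>. \<pi> permutes {1..n}} = fact n" by (rule card_permutations) simp_all
    with assms(2) obtain S where "S \<subseteq> {\<pi>. \<pi> permutes {1..n}}" "card S = k"
      by (metis obtain_subset_with_card_n)
    then obtain a \<pi> where "subseq a (perm_seq n \<pi>)" "length a = f_lcs k n"
      using forced unfolding common_subseq_in_def by blast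
    then have "f_lcs k n \<le> n"
      unfolding perm_seq_def by (auto dest!: list_emb_length simp del: upt_Suc)
    with True show ?thesis by simp
  next
    case False
    have "\<exists>\<pi>. \<pi> permutes {1..n} \<and> perm_seq n \<pi> = L i" if "i < k" for i
      using exists_permutation_with_seq L that by metis
    then obtain \<pi> where \<pi>: "\<And>i. i < k \<Longrightarrow> \<pi> i permutes {1..n}"
      "\<And>i. i < k \<Longrightarrow> perm_seq n (\<pi> i) = L i" by metis
    have "inj_on \<pi> {..<k}"
    proof (rule inj_onI, rule ccontr)
      fix i j assume ij: "i \<in> {..<k}" "j \<in> {..<k}" "\<pi> i = \<pi> j" "i \<noteq> j"
      then have "L i = L j" using \<pi>(2) by (metis lessThan_iff)
      then have "length (L i) \<le> b" using ij bound[of i j "L i"] by simp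
      moreover have "length (L i) = n" using ij distinct_card[OF L(1)] L(2) by fastforce
      ultimately show False using False by simp
    qed
    then have "card (\<pi> ` {..<k}) = k" by (simp add: card_image)
    then obtain a where a: "common_subseq_in n (\<pi> ` {..<k}) a" "length a = f_lcs k n"
      using forced[of "\<pi> ` {..<k}"] \<pi>(1) by blast
    then obtain i j where "i < k" "j < k" "\<pi> i \<noteq> \<pi> j"
      "subseq a (perm_seq n (\<pi> i))" "subseq a (perm_seq n (\<pi> j))"
      unfolding common_subseq_in_def by blast
    then have "length a \<le> b" using bound[of i j a] \<pi>(2) by metis
    with a show ?thesis by simp
  qed
qed

section \<open>The upper bound\<close>

theorem theorem2:
  fixes k n :: nat
  assumes "3 \<le> k" and "real k \<le> real n powr (1/2)"
  shows "real (f_lcs k n) \<le> 32 * (real k * real n) powr (1/3)"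
proof -
  define r where "r = (real k * real n) powr (1/3)"
  have "real k ^ 2 \<le> (real n powr (1/2)) ^ 2" using assms(2) by (intro power_mono) auto
  also have "\<dots> = real n" by (simp add: powr_half_sqrt)
  finally have "real (k ^ 2) \<le> real n" by simp
  then have kn: "k ^ 2 \<le> n" by (simp only: of_nat_le_iff)
  have "n > 0" using kn assms(1) by (intro gr0I) simp
  have "k \<le> k ^ 2" by (simp add: power2_eq_square)
  also note kn
  also have "n \<le> fact n" by (rule fact_ge_self)
  finally have "k \<le> fact n" .
  have r3: "r ^ 3 = real k * real n"
    unfolding r_def using \<open>n > 0\<close> assms(1) by (simp add: powr_power)
  have "r \<ge> 0" unfolding r_def by simp
  have "real k ^ 3 = real k * real (k ^ 2)" by (simp add: power3_eq_cube power2_eq_square)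
  also have "\<dots> \<le> real k * real n"
    using kn by (intro mult_left_mono) (simp_all only: of_nat_le_iff of_nat_0_le_iff)
  finally have "real k ^ 3 \<le> r ^ 3" unfolding r3 .
  then have "real k \<le> r" using \<open>r \<ge> 0\<close> by (simp add: power_mono_iff)
  define N where "N = nat \<lceil>r\<rceil>"
  have N: "r \<le> real N" "real N < r + 1" unfolding N_def using \<open>r \<ge> 0\<close> by linarith+
  have "N \<ge> 1" using N \<open>real k \<le> r\<close> assms(1) by linarith
  then obtain p where p: "prime p" "N < p" "p \<le> 4 * N" by (rule prime_between_and_4_times)
  have "k \<le> p" using \<open>real k \<le> r\<close> N p(2) by linarith
  have "real (k * n) \<le> real (p ^ 3)"
    using power_mono[of r "real p" 3] N p(2) \<open>r \<ge> 0\<close> by (simp flip: r3)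
  then have "k * n \<le> p ^ 3" by (simp only: of_nat_le_iff)
  have "f_lcs k n \<le> 6 * p"
  proof (rule f_lcs_le[where L = "slope_list p n"])
    show "length a \<le> 6 * p"
      if "i < k" "j < k" "i \<noteq> j" "subseq a (slope_list p n i)" "subseq a (slope_list p n j)" for i j a
      using length_common_subseq_slope_lists_le p(1) \<open>k \<le> p\<close> \<open>k * n \<le> p ^ 3\<close> that by blast
  qed (use assms(1) \<open>k \<le> fact n\<close> in \<open>auto simp: slope_list_def simp del: upt_Suc\<close>)
  then have "real (f_lcs k n) \<le> 24 * real N" using p(3) by linarith
  also have "\<dots> \<le> 32 * r" using N \<open>real k \<le> r\<close> assms(1) by linarith
  finally show ?thesis unfolding r_def .
qed

end
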